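(* Let $U, Q \in \mathrm{St}(n,p)$ with $U^T Q = 0$ and $A \in \mathfrak{so}(p)$, $B \in \mathbb{R}^{p \times p}$, $C \in \mathfrak{so}(p)$. Then the curve $$\rho(t) = \begin{pmatrix} U & Q \end{pmatrix}\exp_m\left(t\begin{pmatrix} A & -B^T\\ B & C\end{pmatrix} \right)\begin{pmatrix}I_p \\ 0 \end{pmatrix}$$ has the following properties, where $\rho_\perp(t) := \begin{pmatrix} U & Q \end{pmatrix}\exp_m\left(t\begin{pmatrix} A & -B^T\\ B & C\end{pmatrix} \right)\begin{pmatrix}0 \\ I_p \end{pmatrix}$: 1. $\rho(0) = U$; 2. $\dot\rho(0)=UA + Q B \in T_U\mathrm{St}(n,p)$; 3. $\dot\rho(t)= \begin{pmatrix} U & Q \end{pmatrix}\exp_m\left(t\begin{pmatrix} A & -B^T\\ B & C\end{pmatrix} \right)\begin{pmatrix}A \\ B \end{pmatrix} = \rho(t)A+\rho_\perp(t)B \in T_{\rho(t)}\mathrm{St}(n,p)$; 4. $\|\dot\rho(t)\|^2 = \frac{1}{2}\operatorname{tr}(A^TA) + \operatorname{tr}(B^TB)$ (constant speed); 5. $\ddot\rho(t) = \begin{pmatrix} U & Q \end{pmatrix}\exp_m\left(t\begin{pmatrix} A & -B^T\\ B & C\end{pmatrix} \right)\begin{pmatrix}A^2-B^TB \\ BA+CB \end{pmatrix} = \rho(t)(A^2-B^TB) + \rho_\perp(t)(BA+CB)$; 6. $D_t\dot\rho(t) = \rho_\perp(t)CB$; 7. $\|D_t\dot\rho(t)\|^2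 = \|CB\|_F^2$ (constant-norm covariant acceleration).
   Context: The Stiefel manifold is $\mathrm{St}(n,p) = \{U \in \mathbb{R}^{n \times p} : U^TU=I_p\}$, with tangent space $T_U\mathrm{St}(n,p) = \{UA+U_\perp B : A \in \mathfrak{so}(p),\ B \in \mathbb{R}^{(n-p)\times p}\}$, where $\mathfrak{so}(p)$ denotes the real skew-symmetric $p\times p$ matrices and $U_\perp$ is a fixed orthonormal completion of $U$, i.e. $\begin{pmatrix} U & U_\perp\end{pmatrix}\in \mathrm{O}(n)$. It carries the Riemannian metric given by the canonical inner product $g_U(\Delta_1,\Delta_2)=\operatorname{tr}\left(\Delta_1^T(I_n-\frac12 UU^T)\Delta_2\right)$; for tangent vectors, $\|\cdot\|$ denotes the norm induced by $g$ at the foot point, and $\|\cdot\|_F$ is the Frobenius norm. $\exp_m$ is the matrix exponential. $D_t$ is the covariant derivative along the curve with respect to the Levi-Civita connection of $g$. For a smooth curve $\rho$ in $\mathrm{St}(n,p)$ it is given by the known formula $D_t\dot\rho=\ddot\rho+\dot\rho\dot\rho^T\rho+\rho\left((\rho^T\dot\rho)^2+\dot\rho^T\dot\rho\right)$. *)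

theory Defs
  imports "HOL-Analysis.Analysis"
begin

section \<open>Block matrices and the matrix exponential\<close>

definition hcat :: "'a^'p^'n \<Rightarrow> 'a^'q^'n \<Rightarrow> 'a^('p + 'q)^'n" where
  "hcat M N = (\<chi> i j. case j of Inl k \<Rightarrow> M $ i $ k | Inr k \<Rightarrow> N $ i $ k)"

definition vcat :: "'a^'m^'p \<Rightarrow> 'a^'m^'q \<Rightarrow> 'a^'m^('p + 'q)" where
  "vcat M N = (\<chi> i. case i of Inl k \<Rightarrow> M $ k | Inr k \<Rightarrow> N $ k)"

primrec mat_pow :: "real^'m^'m \<Rightarrow> nat \<Rightarrow> real^'m^'m" where
  "mat_pow M 0 = mat 1"
| "mat_pow M (Suc k) = M ** mat_pow M k"

definition mat_exp :: "real^'m^'m \<Rightarrow> real^'m^'m" where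
  "mat_exp M = (\<Sum>k. (1 / fact k) *\<^sub>R mat_pow M k)"

definition skew_symmetric :: "real^'m^'m \<Rightarrow> bool" where
  "skew_symmetric M \<longleftrightarrow> transpose M = - M"

text \<open>The library norm on matrices is the Euclidean norm of the vector of Euclidean norms of
  the rows; see \<open>frobenius_norm_eq\<close>.\<close>

abbreviation frobenius_norm :: "real^'m^'n \<Rightarrow> real" where
  "frobenius_norm M \<equiv> norm M"

lemma frobenius_norm_eq: "frobenius_norm M = sqrt (\<Sum>i\<in>UNIV. \<Sum>j\<in>UNIV. (M $ i $ j)\<^sup>2)"
  for M :: "real^'m^'n"
  by (simp add: norm_vec_def L2_set_def sum_nonneg)

section \<open>The Stiefel manifold\<close>

definition stiefel :: "(real^'p^'n) set" where
  "stiefel = {U. transpose U ** U = mat 1}"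

text \<open>An index type of cardinality \<open>n - p\<close>, where \<open>n = CARD('n)\<close> and \<open>p = CARD('p)\<close>. Types being
  nonempty, it has one element too many when \<open>n \<le> p\<close>; two Stiefel points with
  \<open>transpose U ** Q = 0\<close> can only exist if \<open>n \<ge> 2 * p > p\<close>.\<close>

typedef ('n, 'p) codim = "{i::nat. i = 0 \<or> i < CARD('n) - CARD('p)}"
  by blast

instance codim :: (type, type) finite
proof
  have "finite {i::nat. i = 0 \<or> i < CARD('a) - CARD('b)}"
    by simp
  then have "finite (Abs_codim ` {i::nat. i = 0 \<or> i < CARD('a) - CARD('b)} :: ('a, 'b) codim set)"
    by (rule finite_imageI)
  then show "finite (UNIV :: ('a, 'b) codim set)"
    by (simp only: type_definition.Abs_image[OF type_definition_codim])
qed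

lemma card_codim:
  assumes "CARD('p) < CARD('n)"
  shows "CARD(('n, 'p) codim) = CARD('n) - CARD('p)"
proof -
  have "{i::nat. i = 0 \<or> i < CARD('n) - CARD('p)} = {..<CARD('n) - CARD('p)}"
    using assms by auto
  then show ?thesis
    by (simp only: type_definition.card[OF type_definition_codim] card_lessThan)
qed

text \<open>\<open>(U W) \<in> O(n)\<close>. The column index type of \<open>hcat U W\<close> is not \<open>'n\<close> itself, hence
  \<open>orthogonal_matrix\<close> does not apply to it.\<close>

definition orthonormal_completion :: "real^'p^'n \<Rightarrow> real^('n, 'p) codim^'n \<Rightarrow> bool" where
  "orthonormal_completion U W \<longleftrightarrow>
     transpose (hcat U W) ** hcat U W = mat 1 \<and> hcat U W ** transpose (hcat U W) = mat 1"

definition stiefel_perp :: "real^'p^'n \<Rightarrow> real^('n, 'p) codim^'n" where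
  "stiefel_perp U = (SOME W. orthonormal_completion U W)"

definition stiefel_tangent :: "real^'p^'n \<Rightarrow> (real^'p^'n) set" where
  "stiefel_tangent U =
     {U ** A + stiefel_perp U ** B | (A :: real^'p^'p) (B :: real^'p^('n, 'p) codim).
        skew_symmetric A}"

definition stiefel_metric :: "real^'p^'n \<Rightarrow> real^'p^'n \<Rightarrow> real^'p^'n \<Rightarrow> real" where
  "stiefel_metric U X Y = trace (transpose X ** (mat 1 - (1/2) *\<^sub>R (U ** transpose U)) ** Y)"

definition stiefel_norm :: "real^'p^'n \<Rightarrow> real^'p^'n \<Rightarrow> real" where
  "stiefel_norm U X = sqrt (stiefel_metric U X X)"

section \<open>Covariant derivative along curves\<close>

definition smooth_curve :: "(real \<Rightarrow> 'a::real_normed_vector) \<Rightarrow> bool" where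
  "smooth_curve f \<longleftrightarrow>
     (\<exists>D. D 0 = f \<and> (\<forall>k t. (D k has_vector_derivative D (Suc k) t) (at t)))"

definition smooth_stiefel_curve :: "(real \<Rightarrow> real^'p^'n) \<Rightarrow> bool" where
  "smooth_stiefel_curve \<gamma> \<longleftrightarrow> smooth_curve \<gamma> \<and> (\<forall>t. \<gamma> t \<in> stiefel)"

definition smooth_field_along :: "(real \<Rightarrow> real^'p^'n) \<Rightarrow> (real \<Rightarrow> real^'p^'n) \<Rightarrow> bool" where
  "smooth_field_along \<gamma> V \<longleftrightarrow> smooth_curve V \<and> (\<forall>t. V t \<in> stiefel_tangent (\<gamma> t))"

text \<open>Every affine connection on the embedded submanifold \<open>stiefel\<close> has the form
  \<open>D\<^sub>t V = V' + \<Gamma>(\<gamma>; \<gamma>', V)\<close> for a field \<open>V\<close> along a curve \<open>\<gamma>\<close>, where \<open>\<Gamma>(U; _, _)\<close> is bilinear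
  with values in the ambient matrix space. Only its values on tangent vectors at \<open>U\<close> matter, and
  a bilinear map on the tangent space extends to the ambient space.\<close>

definition cov_deriv_along ::
  "(real^'p^'n \<Rightarrow> real^'p^'n \<Rightarrow> real^'p^'n \<Rightarrow> real^'p^'n) \<Rightarrow>
   (real \<Rightarrow> real^'p^'n) \<Rightarrow> (real \<Rightarrow> real^'p^'n) \<Rightarrow> real \<Rightarrow> real^'p^'n" where
  "cov_deriv_along \<Gamma> \<gamma> V t =
     vector_derivative V (at t) + \<Gamma> (\<gamma> t) (vector_derivative \<gamma> (at t)) (V t)"

definition stiefel_connection ::
  "(real^'p^'n \<Rightarrow> real^'p^'n \<Rightarrow> real^'p^'n \<Rightarrow> real^'p^'n) \<Rightarrow> bool" where
  "stiefel_connection \<Gamma> \<longleftrightarrow>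
     (\<forall>U\<in>stiefel. bilinear (\<Gamma> U)) \<and>
     (\<forall>\<gamma> V. smooth_stiefel_curve \<gamma> \<longrightarrow> smooth_field_along \<gamma> V \<longrightarrow>
        smooth_field_along \<gamma> (cov_deriv_along \<Gamma> \<gamma> V))"

text \<open>The torsion of the connection is \<open>\<Gamma>(U; X, Y) - \<Gamma>(U; Y, X)\<close>, since the ambient derivative
  parts cancel against the Lie bracket.\<close>

definition torsion_free ::
  "(real^'p^'n \<Rightarrow> real^'p^'n \<Rightarrow> real^'p^'n \<Rightarrow> real^'p^'n) \<Rightarrow> bool" where
  "torsion_free \<Gamma> \<longleftrightarrow>
     (\<forall>U\<in>stiefel. \<forall>X\<in>stiefel_tangent U. \<forall>Y\<in>stiefel_tangent U. \<Gamma> U X Y = \<Gamma> U Y X)"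

definition metric_compatible ::
  "(real^'p^'n \<Rightarrow> real^'p^'n \<Rightarrow> real^'p^'n \<Rightarrow> real^'p^'n) \<Rightarrow> bool" where
  "metric_compatible \<Gamma> \<longleftrightarrow>
     (\<forall>\<gamma> V W. smooth_stiefel_curve \<gamma> \<longrightarrow> smooth_field_along \<gamma> V \<longrightarrow> smooth_field_along \<gamma> W \<longrightarrow>
        (\<forall>t. ((\<lambda>s. stiefel_metric (\<gamma> s) (V s) (W s)) has_real_derivative
               stiefel_metric (\<gamma> t) (cov_deriv_along \<Gamma> \<gamma> V t) (W t) +
               stiefel_metric (\<gamma> t) (V t) (cov_deriv_along \<Gamma> \<gamma> W t)) (at t)))"

text \<open>The Levi-Civita connection is unique on tangent vectors, so the choice does not affect
  covariant derivatives of tangent fields.\<close>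

definition levi_civita :: "real^'p^'n \<Rightarrow> real^'p^'n \<Rightarrow> real^'p^'n \<Rightarrow> real^'p^'n" where
  "levi_civita = (SOME \<Gamma>. stiefel_connection \<Gamma> \<and> torsion_free \<Gamma> \<and> metric_compatible \<Gamma>)"

definition stiefel_cov_deriv ::
  "(real \<Rightarrow> real^'p^'n) \<Rightarrow> (real \<Rightarrow> real^'p^'n) \<Rightarrow> real \<Rightarrow> real^'p^'n" where
  "stiefel_cov_deriv = cov_deriv_along levi_civita"

end

theory Submission
  imports Defs
begin

text \<open>
  Write \<open>M\<close> for the skew-symmetric block matrix in the exponent and \<open>K t = (U Q) exp (t M)\<close>. Since
  \<open>exp (t M)\<close> is orthogonal and commutes with \<open>M\<close>, the columns of \<open>K t\<close> stay orthonormal and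
  \<open>K' = K M\<close>. Hence \<open>\<rho>\<close> and \<open>\<rho>perp\<close>, the two halves of \<open>K\<close>, form an orthonormal frame, the first
  two derivatives of \<open>\<rho>\<close> come from applying \<open>M\<close> to \<open>(1; 0)\<close> and to \<open>(A; B)\<close>, and all the norms are
  computed in that frame (\<open>orthonormal_frame_velocity\<close>).

  The covariant derivative needs more, because the Levi-Civita connection is given only by a choice
  among all torsion-free metric connections. Its formula results from two facts. The explicit form
  \<open>canonical_christoffel\<close> is such a connection (\<open>stiefel_connection_canonical_christoffel\<close> and
  \<open>metric_compatible_canonical_christoffel\<close>), so the choice is not vacuous; and two such connections
  agree on tangent vectors (\<open>levi_civita_unique\<close>). For the latter, a tangent vector at \<open>V\<close> is the
  initial velocity of \<open>exp (t \<Omega>) V\<close> for some skew-symmetric \<open>\<Omega>\<close>, and rotated tangent vectors have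
  constant inner products along that curve. Metric compatibility thus says that
  \<open>Y \<mapsto> \<Omega> Y + \<Gamma>(X, Y)\<close> is skew-adjoint; in the difference of two connections the term \<open>\<Omega> Y\<close>
  cancels, and a trilinear form that is symmetric in its first two and alternating in its last two
  arguments is zero.

  Both facts use tangent spaces as kernels, \<open>X\<close> being tangent at \<open>V\<close> iff \<open>transpose V ** X\<close> is
  skew-symmetric (\<open>stiefel_tangent_iff\<close>), which rests on the existence of orthonormal completions
  and so on \<open>p < n\<close>. That inequality holds here because \<open>U\<close> and \<open>Q\<close> together have \<open>2 p\<close>
  orthonormal columns in dimension \<open>n\<close>.
\<close>

section \<open>Matrix algebra and the trace inner product\<close>

lemma matrix_add_rdist: "(A + B) ** C = A ** C + B ** C" for A B :: "real^'n^'m"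
  by (vector matrix_matrix_mult_def sum.distrib[symmetric] field_simps)

lemma matrix_minus_left: "(- A) ** B = - (A ** B)" for A :: "real^'n^'m"
  by (simp add: matrix_matrix_mult_def vec_eq_iff sum_negf)

lemma matrix_minus_right: "A ** (- B) = - (A ** B)" for A :: "real^'n^'m"
  by (simp add: matrix_matrix_mult_def vec_eq_iff sum_negf)

lemma matrix_diff_left: "(A - B) ** C = A ** C - B ** C" for A B :: "real^'n^'m"
  by (metis matrix_add_rdist matrix_minus_left diff_conv_add_uminus)

lemma matrix_diff_right: "C ** (A - B) = C ** A - C ** B" for A B :: "real^'n^'m"
  by (metis matrix_add_ldistrib matrix_minus_right diff_conv_add_uminus)

lemma transpose_add: "transpose (A + B) = transpose A + transpose B" for A B :: "real^'n^'m"
  by (simp add: transpose_def vec_eq_iff)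

lemma transpose_uminus: "transpose (- A) = - transpose A" for A :: "real^'n^'m"
  by (simp add: transpose_def vec_eq_iff)

lemma transpose_diff: "transpose (A - B) = transpose A - transpose B" for A B :: "real^'n^'m"
  by (simp add: transpose_def vec_eq_iff)

lemma transpose_zero: "transpose 0 = (0 :: real^'n^'m)"
  by (simp add: transpose_def vec_eq_iff)

lemmas matrix_ring_simps =
  matrix_add_ldistrib matrix_add_rdist matrix_minus_left matrix_minus_right
  matrix_diff_left matrix_diff_right matrix_mul_assoc matrix_transpose_mul
  transpose_add transpose_uminus transpose_diff transpose_zero transpose_scalar
  scalar_matrix_assoc[symmetric] matrix_scalar_ac scaleR_add_right scaleR_diff_right

lemma bilinear_matrix_mult: "bilinear ((**) :: real^'n^'m \<Rightarrow> real^'k^'n \<Rightarrow> real^'k^'m)"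
  unfolding bilinear_def by (auto intro!: linearI simp: matrix_ring_simps)

lemma bounded_bilinear_matrix_mult:
  "bounded_bilinear ((**) :: real^'n^'m \<Rightarrow> real^'k^'n \<Rightarrow> real^'k^'m)"
  using bilinear_matrix_mult by (simp add: bilinear_conv_bounded_bilinear)

lemma bounded_linear_transpose: "bounded_linear (transpose :: real^'n^'m \<Rightarrow> real^'m^'n)"
  by (simp add: linear_conv_bounded_linear[symmetric] linearI transpose_add transpose_scalar)

lemma transpose_mult_isometry:
  fixes K :: "real^'m^'n" and X :: "real^'k^'m" and Y :: "real^'l^'m"
  assumes "transpose K ** K = mat 1"
  shows "transpose (K ** X) ** (K ** Y) = transpose X ** Y"
proof -
  have "transpose (K ** X) ** (K ** Y) = transpose X ** (transpose K ** K) ** Y"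
    by (simp only: matrix_transpose_mul matrix_mul_assoc)
  with assms show ?thesis by simp
qed

lemma trace_transpose_mult: "trace (transpose X ** Y) = X \<bullet> Y" for X Y :: "real^'p^'n"
  unfolding trace_def matrix_matrix_mult_def transpose_def inner_vec_def
  by simp (rule sum.swap)

lemma inner_mult_left_adjoint: "(A ** X) \<bullet> Y = X \<bullet> (transpose A ** Y)"
  for A :: "real^'m^'n" and X :: "real^'p^'m"
  by (simp add: trace_transpose_mult[symmetric] matrix_transpose_mul matrix_mul_assoc)

lemma inner_mult_right_adjoint: "(X ** A) \<bullet> Y = X \<bullet> (Y ** transpose A)"
  for A :: "real^'q^'p" and X :: "real^'p^'n"
  using trace_mul_sym[of "transpose A" "transpose X ** Y"]
  by (simp add: trace_transpose_mult[symmetric] matrix_transpose_mul matrix_mul_assoc)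

lemma inner_transpose: "transpose X \<bullet> transpose Y = X \<bullet> Y" for X Y :: "real^'p^'n"
  by (metis trace_transpose_mult trace_mul_sym transpose_transpose inner_commute)

lemma inner_symmetric_skew:
  assumes "transpose S = S" "skew_symmetric A"
  shows "S \<bullet> A = 0"
  using inner_transpose[of S A] assms by (simp add: skew_symmetric_def)

text \<open>A matrix with orthonormal columns has at least as many rows as columns, and it is orthogonal
  in case of equality: \<open>M ** transpose M\<close> is an orthogonal projection of rank \<open>CARD('k)\<close>, so the
  complementary projection has squared Frobenius norm \<open>CARD('n) - CARD('k)\<close>.\<close>

lemma norm_complementary_projection:
  fixes M :: "real^'k^'n"
  assumes "transpose M ** M = mat 1"
  shows "(norm (mat 1 - M ** transpose M))\<^sup>2 = real CARD('n) - real CARD('k)"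
proof -
  have "M ** transpose M ** M = M"
    using assms by (simp add: matrix_mul_assoc[symmetric])
  then have "transpose (mat 1 - M ** transpose M) ** (mat 1 - M ** transpose M)
      = mat 1 - M ** transpose M"
    by (simp add: matrix_ring_simps)
  then show ?thesis
    by (simp add: power2_norm_eq_inner trace_transpose_mult[symmetric] trace_sub trace_I
        trace_mul_sym[of M] assms)
qed

section \<open>Block matrices\<close>

lemma sum_UNIV_Plus:
  "(\<Sum>k\<in>UNIV. f k) = (\<Sum>k\<in>UNIV. f (Inl k)) + (\<Sum>k\<in>UNIV. f (Inr k))"
  for f :: "'a::finite + 'b::finite \<Rightarrow> real"
  by (simp add: UNIV_Plus_UNIV[symmetric] sum.Plus del: UNIV_Plus_UNIV)

lemma hcat_mult_vcat: "hcat M N ** vcat X Y = M ** X + N ** Y"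
  for M :: "real^'p^'n" and N :: "real^'q^'n"
  by (simp add: vec_eq_iff matrix_matrix_mult_def hcat_def vcat_def sum_UNIV_Plus)

lemma vcat_mult: "vcat M N ** X = vcat (M ** X) (N ** X)"
  for M :: "real^'k^'p" and N :: "real^'k^'q"
  by (auto simp: vec_eq_iff matrix_matrix_mult_def vcat_def split: sum.splits)

lemma mult_hcat: "X ** hcat M N = hcat (X ** M) (X ** N)"
  for M :: "real^'p^'k" and N :: "real^'q^'k"
  by (auto simp: vec_eq_iff matrix_matrix_mult_def hcat_def split: sum.splits)

lemma transpose_hcat: "transpose (hcat M N) = vcat (transpose M) (transpose N)"
  by (auto simp: vec_eq_iff transpose_def hcat_def vcat_def split: sum.splits)

lemma transpose_vcat: "transpose (vcat M N) = hcat (transpose M) (transpose N)"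
  by (auto simp: vec_eq_iff transpose_def hcat_def vcat_def split: sum.splits)

lemma vcat_add: "vcat M N + vcat M' N' = vcat (M + M') (N + N')"
  for M :: "real^'k^'p" and N :: "real^'k^'q"
  by (auto simp: vec_eq_iff vcat_def split: sum.splits)

lemma uminus_vcat: "- vcat M N = vcat (- M) (- N)"
  for M :: "real^'k^'p" and N :: "real^'k^'q"
  by (auto simp: vec_eq_iff vcat_def split: sum.splits)

lemma uminus_hcat: "- hcat M N = hcat (- M) (- N)"
  for M :: "real^'p^'n" and N :: "real^'q^'n"
  by (auto simp: vec_eq_iff hcat_def split: sum.splits)

lemma vcat_hcat_swap: "vcat (hcat K L) (hcat M N) = hcat (vcat K M) (vcat L N)"
  by (auto simp: vec_eq_iff hcat_def vcat_def split: sum.splits)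

lemma mat_1_blocks: "mat 1 = vcat (hcat (mat 1) 0) (hcat 0 (mat 1) :: real^('p::finite + 'q::finite)^'q)"
  by (auto simp: vec_eq_iff mat_def hcat_def vcat_def split: sum.splits)

section \<open>The matrix exponential\<close>

lemma mat_pow_commute: "mat_pow M k ** M = M ** mat_pow M k"
  by (induction k) (simp_all add: matrix_mul_assoc[symmetric])

lemma mat_pow_scaleR: "mat_pow (t *\<^sub>R M) k = t ^ k *\<^sub>R mat_pow M k"
  by (induction k) (simp_all add: matrix_ring_simps)

lemma summable_mat_exp: "summable (\<lambda>k. (1 / fact k) *\<^sub>R mat_pow M k)"
for M :: "real^'a^'a"
proof -
  obtain K where K: "K > 0" "\<And>(A :: real^'a^'a) (B :: real^'a^'a). norm (A ** B) \<le> norm A * norm B * K"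
    using bounded_bilinear.pos_bounded[OF bounded_bilinear_matrix_mult] by blast
  define c where "c = norm (mat 1 :: real^'a^'a)"
  have *: "norm (mat_pow M k) \<le> c * (norm M * K) ^ k" for k
  proof (induction k)
    case (Suc k)
    have "norm (mat_pow M (Suc k)) \<le> norm M * norm (mat_pow M k) * K"
      using K(2)[of M "mat_pow M k"] by simp
    also have "\<dots> \<le> norm M * (c * (norm M * K) ^ k) * K"
      using Suc K(1) by (intro mult_right_mono mult_left_mono) auto
    finally show ?case
      by (simp add: mult_ac)
  qed (simp add: c_def)
  show ?thesis
  proof (rule summable_comparison_test')
    show "summable (\<lambda>k. c * (inverse (fact k) * (norm M * K) ^ k))"
      by (intro summable_mult summable_exp)
    show "norm ((1 / fact k) *\<^sub>R mat_pow M k) \<le> c * (inverse (fact k) * (norm M * K) ^ k)" for k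
      using *[of k] by (simp add: field_simps)
  qed
qed

lemma mat_exp_commute: "mat_exp M ** M = M ** mat_exp M"
proof -
  note bl = bounded_bilinear.bounded_linear_left[OF bounded_bilinear_matrix_mult]
    bounded_bilinear.bounded_linear_right[OF bounded_bilinear_matrix_mult]
  show ?thesis
    unfolding mat_exp_def bounded_linear.suminf[OF bl(1) summable_mat_exp]
      bounded_linear.suminf[OF bl(2) summable_mat_exp]
    by (simp add: matrix_ring_simps mat_pow_commute)
qed

lemma mat_exp_zero: "mat_exp 0 = mat 1"
proof -
  have "(\<lambda>k. (1 / fact k) *\<^sub>R mat_pow (0 :: real^'a^'a) k) = (\<lambda>k. if k = 0 then mat 1 else 0)"
  proof
    show "(1 / fact k) *\<^sub>R mat_pow (0 :: real^'a^'a) k = (if k = 0 then mat 1 else 0)" for k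
      by (cases k) auto
  qed
  then show ?thesis
    unfolding mat_exp_def using sums_single[of 0 "\<lambda>_. mat 1 :: real^'a^'a"] by (simp add: sums_iff)
qed

lemma has_vector_derivative_entrywise:
  fixes f :: "real \<Rightarrow> real^'m^'n"
  assumes "\<And>i j. ((\<lambda>t. f t $ i $ j) has_real_derivative f' $ i $ j) (at t)"
  shows "(f has_vector_derivative f') (at t)"
  unfolding has_vector_derivative_def has_derivative_componentwise_within[of f]
proof
  fix b :: "real^'m^'n" assume "b \<in> Basis"
  then obtain i j where b: "b = axis i (axis j 1)"
    by (auto simp: Basis_vec_def)
  show "((\<lambda>x. f x \<bullet> b) has_derivative (\<lambda>x. x *\<^sub>R f' \<bullet> b)) (at t)"
    using assms[of i j] by (simp add: b inner_axis has_field_derivative_def mult_commute_abs)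
qed

text \<open>Entrywise, the exponential is a real power series, which can be differentiated termwise.\<close>

lemma has_vector_derivative_mat_exp:
  "((\<lambda>t. mat_exp (t *\<^sub>R M)) has_vector_derivative M ** mat_exp (t *\<^sub>R M)) (at t)"
proof (rule has_vector_derivative_entrywise)
  fix i j
  define c where "c k = mat_pow M k $ i $ j / fact k" for k
  have bl: "bounded_linear (\<lambda>X :: real^'a^'a. X $ i $ j)"
    by (rule bounded_linear_compose[OF bounded_linear_vec_nth bounded_linear_vec_nth])
  have sm: "(\<lambda>k. c k * s ^ k) sums (mat_exp (s *\<^sub>R M) $ i $ j)" for s
    using bounded_linear.sums[OF bl summable_sums[OF summable_mat_exp[of "s *\<^sub>R M"]]]
    by (simp add: mat_exp_def c_def mat_pow_scaleR field_simps)
  have bl': "bounded_linear (\<lambda>X :: real^'a^'a. (M ** X) $ i $ j)"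
    by (rule bounded_linear_compose[OF bl
          bounded_bilinear.bounded_linear_right[OF bounded_bilinear_matrix_mult]])
  have "(\<lambda>k. diffs c k * t ^ k) sums ((M ** mat_exp (t *\<^sub>R M)) $ i $ j)"
    using bounded_linear.sums[OF bl' summable_sums[OF summable_mat_exp[of "t *\<^sub>R M"]]]
    by (simp add: mat_exp_def c_def diffs_def mat_pow_scaleR matrix_ring_simps field_simps
        del: of_nat_Suc)
  moreover have "((\<lambda>t. \<Sum>k. c k * t ^ k) has_real_derivative (\<Sum>k. diffs c k * t ^ k)) (at t)"
    using sm by (intro termdiffs_strong_converges_everywhere) (auto simp: sums_iff)
  ultimately show "((\<lambda>t. mat_exp (t *\<^sub>R M) $ i $ j) has_real_derivative
      (M ** mat_exp (t *\<^sub>R M)) $ i $ j) (at t)"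
    using sm by (simp add: sums_iff)
qed

lemma mat_exp_scaleR_commute: "mat_exp (t *\<^sub>R M) ** M = M ** mat_exp (t *\<^sub>R M)"
proof (cases "t = 0")
  case False
  have "t *\<^sub>R (mat_exp (t *\<^sub>R M) ** M) = t *\<^sub>R (M ** mat_exp (t *\<^sub>R M))"
    using mat_exp_commute[of "t *\<^sub>R M"] by (simp add: matrix_ring_simps)
  with False show ?thesis by simp
qed (simp add: mat_exp_zero)

lemma mat_exp_skew_orthogonal:
  assumes "skew_symmetric M"
  shows "transpose (mat_exp (t *\<^sub>R M)) ** mat_exp (t *\<^sub>R M) = mat 1"
proof -
  let ?E = "\<lambda>t. mat_exp (t *\<^sub>R M)"
  have "((\<lambda>s. transpose (?E s) ** ?E s) has_derivative (\<lambda>h. 0)) (at s)" for s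
    using bounded_bilinear.has_vector_derivative[OF bounded_bilinear_matrix_mult
        bounded_linear.has_vector_derivative[OF bounded_linear_transpose
          has_vector_derivative_mat_exp[of M s]] has_vector_derivative_mat_exp[of M s]] assms
    by (simp add: has_vector_derivative_def matrix_ring_simps skew_symmetric_def)
  then obtain c where "\<forall>s\<in>UNIV. transpose (?E s) ** ?E s = c"
    using has_derivative_zero_constant[of UNIV "\<lambda>s. transpose (?E s) ** ?E s"] by auto
  then show ?thesis
    by (metis UNIV_I mat_exp_zero scaleR_zero_left transpose_mat matrix_mul_lid)
qed

section \<open>Smooth curves\<close>

text \<open>A curve is \<open>n\<close> times differentiable. Smoothness is \<open>n\<close>-fold differentiability for all \<open>n\<close>;
  in this form closure under products is a plain induction, which avoids the binomial
  coefficients of the Leibniz formula for the \<open>n\<close>-th derivative.\<close>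

primrec times_differentiable :: "nat \<Rightarrow> (real \<Rightarrow> 'a::real_normed_vector) \<Rightarrow> bool" where
  "times_differentiable 0 f \<longleftrightarrow> True"
| "times_differentiable (Suc n) f \<longleftrightarrow>
     (\<exists>g. (\<forall>t. (f has_vector_derivative g t) (at t)) \<and> times_differentiable n g)"

lemma times_differentiable_Suc_vector_derivative:
  "times_differentiable (Suc n) f \<longleftrightarrow>
     (\<forall>t. (f has_vector_derivative vector_derivative f (at t)) (at t)) \<and>
     times_differentiable n (\<lambda>t. vector_derivative f (at t))"
proof
  assume "times_differentiable (Suc n) f"
  then obtain g where g: "\<And>t. (f has_vector_derivative g t) (at t)" "times_differentiable n g"
    by auto
  then have "g = (\<lambda>t. vector_derivative f (at t))"
    using vector_derivative_at[OF g(1)] by (intro ext) (rule sym)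
  with g show "(\<forall>t. (f has_vector_derivative vector_derivative f (at t)) (at t)) \<and>
     times_differentiable n (\<lambda>t. vector_derivative f (at t))"
    by blast
next
  assume "(\<forall>t. (f has_vector_derivative vector_derivative f (at t)) (at t)) \<and>
     times_differentiable n (\<lambda>t. vector_derivative f (at t))"
  then show "times_differentiable (Suc n) f"
    unfolding times_differentiable.simps
    by (intro exI[of _ "\<lambda>t. vector_derivative f (at t)"])
qed

lemma smooth_curve_iff_times_differentiable:
  "smooth_curve f \<longleftrightarrow> (\<forall>n. times_differentiable n f)"
proof
  assume "smooth_curve f"
  then obtain D where D: "D 0 = f" "\<And>k t. (D k has_vector_derivative D (Suc k) t) (at t)"
    by (auto simp: smooth_curve_def)
  have "times_differentiable n (D k)" for n k
  proof (induction n arbitrary: k)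
    case (Suc n)
    then show ?case
      unfolding times_differentiable.simps using D(2)
      by (intro exI[of _ "D (Suc k)"] conjI allI)
  qed simp
  from this[of _ 0] show "\<forall>n. times_differentiable n f"
    by (simp add: D(1))
next
  assume *: "\<forall>n. times_differentiable n f"
  define D where "D k = ((\<lambda>g t. vector_derivative g (at t)) ^^ k) f" for k
  have "times_differentiable n (D k)" for n k
  proof (induction k arbitrary: n)
    case (Suc k)
    have "D (Suc k) = (\<lambda>t. vector_derivative (D k) (at t))"
      by (simp add: D_def)
    with Suc[of "Suc n"] show ?case
      unfolding times_differentiable_Suc_vector_derivative by simp
  qed (use * in \<open>simp add: D_def\<close>)
  then have "times_differentiable (Suc 0) (D k)" for k .
  then have "(D k has_vector_derivative D (Suc k) t) (at t)" for k t
    unfolding times_differentiable_Suc_vector_derivative by (simp add: D_def)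
  moreover have "D 0 = f" by (simp add: D_def)
  ultimately show "smooth_curve f"
    unfolding smooth_curve_def by blast
qed

lemma times_differentiable_mono: "times_differentiable (Suc n) f \<Longrightarrow> times_differentiable n f"
proof (induction n arbitrary: f)
  case (Suc n)
  then show ?case
    unfolding times_differentiable.simps(2)[of "Suc n"] times_differentiable.simps(2)[of n f]
    by blast
qed simp

lemma times_differentiable_add:
  assumes "times_differentiable n f" "times_differentiable n g"
  shows "times_differentiable n (\<lambda>t. f t + g t)"
  using assms
proof (induction n arbitrary: f g)
  case (Suc n)
  from Suc.prems obtain f' g' where "\<And>t. (f has_vector_derivative f' t) (at t)" "times_differentiable n f'"
    and "\<And>t. (g has_vector_derivative g' t) (at t)" "times_differentiable n g'"
    by auto
  with Suc.IH[of f' g'] show ?case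
    unfolding times_differentiable.simps
    by (intro exI[of _ "\<lambda>t. f' t + g' t"] conjI allI has_vector_derivative_add) auto
qed simp

lemma times_differentiable_bilinear:
  assumes "bounded_bilinear h" "times_differentiable n f" "times_differentiable n g"
  shows "times_differentiable n (\<lambda>t. h (f t) (g t))"
  using assms(2,3)
proof (induction n arbitrary: f g)
  case (Suc n)
  from Suc.prems obtain f' g' where f': "\<And>t. (f has_vector_derivative f' t) (at t)" "times_differentiable n f'"
    and g': "\<And>t. (g has_vector_derivative g' t) (at t)" "times_differentiable n g'"
    by auto
  have "times_differentiable n (\<lambda>t. h (f t) (g' t) + h (f' t) (g t))"
    by (intro times_differentiable_add Suc.IH f' g' Suc.prems[THEN times_differentiable_mono])
  moreover have "((\<lambda>t. h (f t) (g t)) has_vector_derivative h (f t) (g' t) + h (f' t) (g t)) (at t)"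
    for t
    by (rule bounded_bilinear.has_vector_derivative[OF assms(1) f'(1) g'(1)])
  ultimately show ?case
    unfolding times_differentiable.simps
    by (intro exI[of _ "\<lambda>t. h (f t) (g' t) + h (f' t) (g t)"] conjI allI)
qed simp

lemma times_differentiable_linear:
  assumes "bounded_linear h" "times_differentiable n f"
  shows "times_differentiable n (\<lambda>t. h (f t))"
  using assms(2)
proof (induction n arbitrary: f)
  case (Suc n)
  from Suc.prems obtain f' where f': "\<And>t. (f has_vector_derivative f' t) (at t)" "times_differentiable n f'"
    by auto
  then show ?case
    unfolding times_differentiable.simps
    by (intro exI[of _ "\<lambda>t. h (f' t)"] conjI allI Suc.IH
        bounded_linear.has_vector_derivative[OF assms(1)])
qed simp

lemma smooth_curve_has_vector_derivative:
  "smooth_curve f \<Longrightarrow> (f has_vector_derivative vector_derivative f (at t)) (at t)"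
  unfolding smooth_curve_iff_times_differentiable
  using times_differentiable_Suc_vector_derivative by blast

lemma smooth_curve_vector_derivative:
  "smooth_curve f \<Longrightarrow> smooth_curve (\<lambda>t. vector_derivative f (at t))"
  unfolding smooth_curve_iff_times_differentiable
  using times_differentiable_Suc_vector_derivative by blast

lemma smooth_curve_add: "smooth_curve f \<Longrightarrow> smooth_curve g \<Longrightarrow> smooth_curve (\<lambda>t. f t + g t)"
  by (simp add: smooth_curve_iff_times_differentiable times_differentiable_add)

lemma smooth_curve_linear: "bounded_linear h \<Longrightarrow> smooth_curve f \<Longrightarrow> smooth_curve (\<lambda>t. h (f t))"
  by (simp add: smooth_curve_iff_times_differentiable times_differentiable_linear)

lemma smooth_curve_matrix_mult:
  "smooth_curve f \<Longrightarrow> smooth_curve g \<Longrightarrow> smooth_curve (\<lambda>t. f t ** g t)"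
  for f :: "real \<Rightarrow> real^'m^'n" and g :: "real \<Rightarrow> real^'k^'m"
  by (simp add: smooth_curve_iff_times_differentiable
      times_differentiable_bilinear[OF bounded_bilinear_matrix_mult])

lemma smooth_curve_transpose: "smooth_curve f \<Longrightarrow> smooth_curve (\<lambda>t. transpose (f t))"
  for f :: "real \<Rightarrow> real^'m^'n"
  by (rule smooth_curve_linear[OF bounded_linear_transpose])

lemma smooth_curve_scaleR: "smooth_curve f \<Longrightarrow> smooth_curve (\<lambda>t. c *\<^sub>R f t)"
  by (rule smooth_curve_linear[OF bounded_linear_scaleR_right])

lemma smooth_curve_const: "smooth_curve (\<lambda>t. c)"
  unfolding smooth_curve_def
  by (rule exI[of _ "\<lambda>k t. if k = 0 then c else 0"]) auto

lemma smooth_curve_mat_exp: "smooth_curve (\<lambda>t. mat_exp (t *\<^sub>R M))"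
proof -
  have "((\<lambda>t. mat_pow M k ** mat_exp (t *\<^sub>R M)) has_vector_derivative
      mat_pow M (Suc k) ** mat_exp (t *\<^sub>R M)) (at t)" for k t
    using bounded_linear.has_vector_derivative[OF
        bounded_bilinear.bounded_linear_right[OF bounded_bilinear_matrix_mult, of "mat_pow M k"]
        has_vector_derivative_mat_exp[of M t]]
    by (simp add: matrix_mul_assoc mat_pow_commute)
  then show ?thesis
    unfolding smooth_curve_def
    by (intro exI[of _ "\<lambda>k t. mat_pow M k ** mat_exp (t *\<^sub>R M)"]) auto
qed

lemmas smooth_curve_intros = smooth_curve_add smooth_curve_matrix_mult smooth_curve_transpose
  smooth_curve_scaleR smooth_curve_const smooth_curve_mat_exp smooth_curve_vector_derivative

section \<open>Tangent spaces of the Stiefel manifold\<close>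

lemma stiefelD: "U \<in> stiefel \<Longrightarrow> transpose U ** U = mat 1"
  by (simp add: stiefel_def)

lemma stiefel_cancel: "U \<in> stiefel \<Longrightarrow> X ** transpose U ** U = X"
  by (simp only: stiefelD matrix_mul_assoc[symmetric] matrix_mul_rid)

lemma gram_hcat:
  "transpose (hcat U W) ** hcat U W =
     vcat (hcat (transpose U ** U) (transpose U ** W)) (hcat (transpose W ** U) (transpose W ** W))"
  for U :: "real^'p^'n" and W :: "real^'q^'n"
  by (simp only: transpose_hcat mult_hcat vcat_mult vcat_hcat_swap)

lemma transpose_hcat_mult_hcat_orthonormal:
  fixes U :: "real^'p^'n" and W :: "real^'q^'n"
  assumes "transpose U ** U = mat 1" "transpose W ** W = mat 1" "transpose U ** W = 0"
  shows "transpose (hcat U W) ** hcat U W = mat 1"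
proof -
  have "transpose W ** U = 0"
    using arg_cong[OF assms(3), of transpose]
    by (simp only: matrix_transpose_mul transpose_zero transpose_transpose)
  with assms show ?thesis
    by (simp only: gram_hcat mat_1_blocks)
qed

lemma card_less_if_orthogonal_frames:
  fixes U Q :: "real^'p^'n"
  assumes "U \<in> stiefel" "Q \<in> stiefel" "transpose U ** Q = 0"
  shows "CARD('p) < CARD('n)"
proof -
  have "transpose (hcat U Q) ** hcat U Q = mat 1"
    using assms(1,2)[THEN stiefelD] assms(3) by (rule transpose_hcat_mult_hcat_orthonormal)
  then have "0 \<le> real CARD('n) - real CARD('p + 'p)"
    using norm_complementary_projection zero_le_power2 by metis
  then have "CARD('p + 'p) \<le> CARD('n)" by simp
  then have "CARD('p) + CARD('p) \<le> CARD('n)" by (simp add: card_UNIV_sum)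
  moreover have "0 < CARD('p)" by simp
  ultimately show ?thesis by linarith
qed

lemma orthonormal_completion_exists:
  fixes U :: "real^'p^'n"
  assumes U: "U \<in> stiefel" and card: "CARD('p) < CARD('n)"
  shows "\<exists>W. orthonormal_completion U W"
proof -
  define T where "T = {y. \<forall>x\<in>span (columns U). orthogonal x y}"
  have "subspace T"
    unfolding T_def by (rule subspace_orthogonal_to_vectors)
  then obtain B where B: "B \<subseteq> T" "pairwise orthogonal B" "\<forall>x\<in>B. norm x = 1"
      "independent B" "card B = dim T"
    by (rule orthonormal_basis_subspace) (rule that; blast)
  have "dim T + dim (span (columns U)) = CARD('n)"
    using dim_subspace_orthogonal_to_vectors[of "span (columns U)" UNIV] by (simp add: T_def)
  moreover have "dim (span (columns U)) \<le> CARD('p)"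
  proof -
    have "columns U = (\<lambda>i. column i U) ` UNIV"
      by (auto simp: columns_def)
    then have "finite (columns U)" "card (columns U) \<le> CARD('p)"
      by (auto intro: card_image_le)
    then show ?thesis
      using dim_le_card'[of "columns U"] by simp
  qed
  \<comment> \<open>Independence of the columns of \<open>U\<close> is not needed: too many candidates for the columns of the
    completion do no harm.\<close>
  ultimately have "CARD(('n, 'p) codim) \<le> card B"
    using B(5) by (simp add: card_codim[OF card])
  moreover have "finite B"
    using B(4) independent_imp_finite by blast
  ultimately obtain f :: "('n, 'p) codim \<Rightarrow> real^'n" where f: "f ` UNIV \<subseteq> B" "inj f"
    using card_le_inj[of "UNIV :: ('n, 'p) codim set" B] by auto
  define W :: "real^('n, 'p) codim^'n" where "W = (\<chi> i j. f j $ i)"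
  have col: "column j W = f j" for j
    by (simp add: column_def W_def vec_eq_iff)
  have fB: "f j \<in> B" for j using f(1) by auto
  have "f i \<bullet> f j = (if i = j then 1 else 0)" for i j
  proof (cases "i = j")
    case True
    then show ?thesis using B(3) fB[of j] by (simp add: dot_square_norm)
  next
    case False
    then have "f i \<noteq> f j" using f(2) by (auto dest: injD)
    with B(2) fB have "orthogonal (f i) (f j)" by (simp add: pairwise_def)
    with False show ?thesis by (simp add: orthogonal_def)
  qed
  then have "transpose W ** W = mat 1"
    by (simp add: matrix_mult_transpose_dot_column col mat_def vec_eq_iff)
  moreover have "transpose U ** W = 0"
  proof -
    have "column i U \<bullet> f j = 0" for i j
    proof -
      have "column i U \<in> span (columns U)"
        by (intro span_base) (auto simp: columns_def)
      moreover have "f j \<in> T" using fB B(1) by blast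
      ultimately show ?thesis by (auto simp: T_def orthogonal_def)
    qed
    then show ?thesis
      by (simp add: vec_eq_iff matrix_matrix_mult_def transpose_def W_def column_def inner_vec_def)
  qed
  ultimately have *: "transpose (hcat U W) ** hcat U W = mat 1"
    using stiefelD[OF U] by (intro transpose_hcat_mult_hcat_orthonormal)
  \<comment> \<open>The index types have equally many elements, so that the left inverse is a right inverse.\<close>
  have "CARD('p + ('n, 'p) codim) = CARD('n)"
    using card by (simp add: card_codim[OF card])
  then have "(norm (mat 1 - hcat U W ** transpose (hcat U W)))\<^sup>2 = 0"
    by (simp only: norm_complementary_projection[OF *] diff_self)
  then have "hcat U W ** transpose (hcat U W) = mat 1"
    by simp
  with * show ?thesis
    unfolding orthonormal_completion_def by blast
qed

text \<open>The tangent space is also the kernel of the differential of the constraint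
  \<open>transpose U ** U = mat 1\<close>, a description that no longer mentions a completion of \<open>U\<close>.\<close>

lemma stiefel_tangent_iff:
  fixes U X :: "real^'p^'n"
  assumes U: "U \<in> stiefel" and card: "CARD('p) < CARD('n)"
  shows "X \<in> stiefel_tangent U \<longleftrightarrow> skew_symmetric (transpose U ** X)"
proof -
  define W where "W = stiefel_perp U"
  have "orthonormal_completion U W"
    unfolding W_def stiefel_perp_def using orthonormal_completion_exists[OF assms] by (rule someI_ex)
  then have 1: "transpose (hcat U W) ** hcat U W = mat 1"
    and 2: "U ** transpose U + W ** transpose W = mat 1"
    by (simp_all add: orthonormal_completion_def transpose_hcat hcat_mult_vcat)
  have "vcat (hcat (transpose U ** U) (transpose U ** W)) (hcat (transpose W ** U) (transpose W ** W))
      = vcat (hcat (mat 1) 0) (hcat 0 (mat 1))"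
    using 1 by (simp only: gram_hcat mat_1_blocks)
  then have UW: "transpose U ** W = 0"
    by (simp add: vec_eq_iff vcat_def hcat_def split: sum.splits)
  show ?thesis
  proof
    assume "X \<in> stiefel_tangent U"
    then obtain A B where "X = U ** A + W ** B" "skew_symmetric A"
      by (auto simp: stiefel_tangent_def W_def)
    then show "skew_symmetric (transpose U ** X)"
      using UW stiefelD[OF U] by (simp add: matrix_add_ldistrib matrix_mul_assoc)
  next
    assume sk: "skew_symmetric (transpose U ** X)"
    have "X = (U ** transpose U + W ** transpose W) ** X"
      by (simp add: 2)
    also have "\<dots> = U ** (transpose U ** X) + W ** (transpose W ** X)"
      by (simp add: matrix_add_rdist matrix_mul_assoc)
    finally show "X \<in> stiefel_tangent U"
      using sk unfolding stiefel_tangent_def W_def by blast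
  qed
qed

lemma stiefel_metric_inner:
  "stiefel_metric U X Y = X \<bullet> Y - 1/2 * ((transpose U ** X) \<bullet> (transpose U ** Y))"
  by (simp add: stiefel_metric_def trace_transpose_mult[symmetric] matrix_ring_simps trace_sub
      trace_def sum_distrib_left sum_subtractf)

text \<open>The metric is positive definite on all matrices, not only on tangent vectors.\<close>

lemma stiefel_metric_zeroD:
  assumes U: "U \<in> stiefel" and "stiefel_metric U X X = 0"
  shows "X = 0"
proof -
  let ?P = "U ** (transpose U ** X)"
  have "?P \<bullet> ?P = (transpose U ** X) \<bullet> (transpose U ** X)"
    and "X \<bullet> ?P = (transpose U ** X) \<bullet> (transpose U ** X)"
    using stiefelD[OF U] inner_mult_left_adjoint[of U "transpose U ** X"]
    by (simp_all add: matrix_mul_assoc inner_commute[of X])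
  then have "X \<bullet> X = (transpose U ** X) \<bullet> (transpose U ** X) + (X - ?P) \<bullet> (X - ?P)"
    by (simp add: inner_diff inner_commute)
  moreover have "X \<bullet> X = 1/2 * ((transpose U ** X) \<bullet> (transpose U ** X))"
    using assms(2) by (simp add: stiefel_metric_inner)
  ultimately have "X \<bullet> X = 0"
    using inner_ge_zero[of "X - ?P"] inner_ge_zero[of "transpose U ** X"] by linarith
  then show ?thesis by simp
qed

section \<open>The Levi-Civita connection\<close>

lemma skew_symmetricD:
  "skew_symmetric (transpose U ** X) \<Longrightarrow> transpose X ** U = - (transpose U ** X)"
  by (simp add: skew_symmetric_def matrix_transpose_mul)

lemma skew_symmetric_diff: "skew_symmetric M \<Longrightarrow> skew_symmetric N \<Longrightarrow> skew_symmetric (M - N)"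
  by (simp add: skew_symmetric_def transpose_diff)

text \<open>The Christoffel form of the canonical metric, that is, the polarization of
  \<open>X \<mapsto> X ** transpose X ** U + U ** ((transpose U ** X)\<^sup>2 + transpose X ** X)\<close>. The base point
  is \<open>U\<close>, the direction of differentiation \<open>X\<close>, and the value of the differentiated field \<open>Y\<close>.\<close>

definition canonical_christoffel ::
  "real^'p^'n \<Rightarrow> real^'p^'n \<Rightarrow> real^'p^'n \<Rightarrow> real^'p^'n" where
  "canonical_christoffel U X Y =
     (1/2) *\<^sub>R (X ** transpose Y ** U + Y ** transpose X ** U
       + U ** (transpose U ** X ** (transpose U ** Y) + transpose U ** Y ** (transpose U ** X)
           + transpose X ** Y + transpose Y ** X))"

lemma canonical_christoffel_commute:
  "canonical_christoffel U X Y = canonical_christoffel U Y X"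
  by (simp add: canonical_christoffel_def add_ac)

lemma bilinear_canonical_christoffel: "bilinear (canonical_christoffel U)"
proof -
  have "linear (canonical_christoffel U X)" for X
    by (rule linearI) (simp_all add: canonical_christoffel_def matrix_ring_simps algebra_simps)
  moreover have "(\<lambda>X. canonical_christoffel U X Y) = canonical_christoffel U Y" for Y
    by (rule ext) (rule canonical_christoffel_commute)
  ultimately show ?thesis by (simp add: bilinear_def)
qed

text \<open>The normal component of \<open>canonical_christoffel U X Y\<close> is determined by this symmetric matrix,
  which is what makes covariant derivatives tangent: differentiating the tangency condition of a
  field \<open>V\<close> along a curve \<open>\<gamma>\<close> shows that \<open>transpose \<gamma> ** V'\<close> differs from a skew-symmetric matrix
  by the negative of the same expression.\<close>

lemma transpose_mult_canonical_christoffel: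
  assumes U: "U \<in> stiefel"
    and X: "skew_symmetric (transpose U ** X)" and Y: "skew_symmetric (transpose U ** Y)"
  shows "transpose U ** canonical_christoffel U X Y = (1/2) *\<^sub>R (transpose X ** Y + transpose Y ** X)"
proof -
  have XU: "L ** transpose X ** U = - (L ** transpose U ** X)" for L :: "real^'a^'m"
    using skew_symmetricD[OF X] by (simp add: matrix_mul_assoc[symmetric] matrix_minus_right)
  have YU: "L ** transpose Y ** U = - (L ** transpose U ** Y)" for L :: "real^'a^'m"
    using skew_symmetricD[OF Y] by (simp add: matrix_mul_assoc[symmetric] matrix_minus_right)
  show ?thesis
    by (simp add: canonical_christoffel_def matrix_ring_simps XU YU stiefelD[OF U])
qed

text \<open>In the pairing with a tangent vector \<open>Z\<close>, the summand of the connection term of the form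
  \<open>U ** S\<close> drops out: \<open>S\<close> is symmetric and \<open>transpose U ** Z\<close> is skew-symmetric. The summand of the
  metric that involves \<open>transpose U\<close> drops out for the same reason.\<close>

lemma stiefel_metric_canonical_christoffel:
  assumes U: "U \<in> stiefel" and X: "skew_symmetric (transpose U ** X)"
    and Y: "skew_symmetric (transpose U ** Y)" and Z: "skew_symmetric (transpose U ** Z)"
  shows "stiefel_metric U (canonical_christoffel U X Y) Z =
    - (1/2) * ((X ** (transpose U ** Y)) \<bullet> Z + (Y ** (transpose U ** X)) \<bullet> Z)"
proof -
  define S where "S = transpose U ** X ** (transpose U ** Y) + transpose U ** Y ** (transpose U ** X)
    + transpose X ** Y + transpose Y ** X"
  have "(transpose U ** canonical_christoffel U X Y) \<bullet> (transpose U ** Z) = 0"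
    by (intro inner_symmetric_skew Z)
      (simp add: transpose_mult_canonical_christoffel[OF U X Y] matrix_ring_simps add_ac)
  moreover have "(U ** S) \<bullet> Z = 0"
  proof -
    have "transpose S = transpose (transpose U ** Y) ** transpose (transpose U ** X)
        + transpose (transpose U ** X) ** transpose (transpose U ** Y)
        + transpose Y ** X + transpose X ** Y"
      by (simp only: S_def transpose_add matrix_transpose_mul[of "transpose U ** _" "transpose U ** _"]
          matrix_transpose_mul[of "transpose X"] matrix_transpose_mul[of "transpose Y"]
          transpose_transpose)
    also have "\<dots> = S"
      using X Y by (simp only: skew_symmetric_def matrix_minus_left matrix_minus_right minus_minus S_def)
        (simp add: add_ac)
    finally show ?thesis
      using inner_symmetric_skew[OF _ Z] by (simp add: inner_mult_left_adjoint)
  qed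
  moreover have "X ** transpose Y ** U = - (X ** (transpose U ** Y))"
    and "Y ** transpose X ** U = - (Y ** (transpose U ** X))"
    using skew_symmetricD[OF X] skew_symmetricD[OF Y]
    by (simp_all add: matrix_mul_assoc[symmetric] matrix_minus_right)
  moreover have "canonical_christoffel U X Y
      = (1/2) *\<^sub>R (X ** transpose Y ** U + Y ** transpose X ** U + U ** S)"
    by (simp only: canonical_christoffel_def S_def)
  ultimately have "canonical_christoffel U X Y \<bullet> Z =
      1/2 * (- (X ** (transpose U ** Y)) \<bullet> Z - (Y ** (transpose U ** X)) \<bullet> Z)"
    by (simp only: inner_add_left inner_diff_left inner_minus_left inner_scaleR_left) simp
  with \<open>(transpose U ** canonical_christoffel U X Y) \<bullet> (transpose U ** Z) = 0\<close> show ?thesis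
    by (simp add: stiefel_metric_inner) (simp add: field_simps)
qed

lemma has_vector_derivative_transpose_mult:
  fixes f g :: "real \<Rightarrow> real^'p^'n"
  assumes "(f has_vector_derivative f') (at t)" "(g has_vector_derivative g') (at t)"
  shows "((\<lambda>s. transpose (f s) ** g s) has_vector_derivative
    transpose (f t) ** g' + transpose f' ** g t) (at t)"
  by (rule bounded_bilinear.has_vector_derivative[OF bounded_bilinear_matrix_mult
        bounded_linear.has_vector_derivative[OF bounded_linear_transpose assms(1)] assms(2)])

lemma skew_symmetric_velocity:
  assumes "smooth_stiefel_curve \<gamma>"
  shows "skew_symmetric (transpose (\<gamma> t) ** vector_derivative \<gamma> (at t))"
proof -
  note d = smooth_curve_has_vector_derivative[of \<gamma> t]
  have "smooth_curve \<gamma>" and "(\<lambda>s. transpose (\<gamma> s) ** \<gamma> s) = (\<lambda>s. mat 1)"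
    using assms by (auto simp: smooth_stiefel_curve_def stiefel_def)
  with has_vector_derivative_transpose_mult[OF d d]
  have "((\<lambda>s. mat 1) has_vector_derivative transpose (\<gamma> t) ** vector_derivative \<gamma> (at t)
      + transpose (vector_derivative \<gamma> (at t)) ** \<gamma> t) (at t)"
    by simp
  then have "transpose (\<gamma> t) ** vector_derivative \<gamma> (at t)
      + transpose (vector_derivative \<gamma> (at t)) ** \<gamma> t = 0"
    by (rule vector_derivative_unique_at[OF _ has_vector_derivative_const])
  then show ?thesis
    by (simp add: skew_symmetric_def matrix_transpose_mul eq_neg_iff_add_eq_0 add.commute)
qed

lemma smooth_field_along_iff:
  fixes \<gamma> V :: "real \<Rightarrow> real^'p^'n"
  assumes "CARD('p) < CARD('n)" "smooth_stiefel_curve \<gamma>"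
  shows "smooth_field_along \<gamma> V \<longleftrightarrow>
    smooth_curve V \<and> (\<forall>t. skew_symmetric (transpose (\<gamma> t) ** V t))"
  using assms by (auto simp: smooth_field_along_def smooth_stiefel_curve_def stiefel_tangent_iff)

lemma stiefel_connection_canonical_christoffel:
  assumes card: "CARD('p) < CARD('n)"
  shows "stiefel_connection
    (canonical_christoffel :: real^'p^'n \<Rightarrow> real^'p^'n \<Rightarrow> real^'p^'n \<Rightarrow> real^'p^'n)"
  unfolding stiefel_connection_def
proof (intro conjI ballI allI impI)
  fix \<gamma> V :: "real \<Rightarrow> real^'p^'n"
  assume \<gamma>: "smooth_stiefel_curve \<gamma>" and "smooth_field_along \<gamma> V"
  then have V: "smooth_curve V" "\<And>t. skew_symmetric (transpose (\<gamma> t) ** V t)"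
    using smooth_field_along_iff[OF card \<gamma>] by auto
  have "smooth_curve \<gamma>" using \<gamma> by (simp add: smooth_stiefel_curve_def)
  then have "smooth_curve (cov_deriv_along canonical_christoffel \<gamma> V)"
    unfolding cov_deriv_along_def[abs_def] canonical_christoffel_def
    using V(1) by (intro smooth_curve_intros)
  moreover have "skew_symmetric (transpose (\<gamma> t) ** cov_deriv_along canonical_christoffel \<gamma> V t)" for t
  proof -
    let ?G = "vector_derivative \<gamma> (at t)" and ?V = "vector_derivative V (at t)"
    note d\<gamma> = smooth_curve_has_vector_derivative[OF \<open>smooth_curve \<gamma>\<close>, of t]
      and dV = smooth_curve_has_vector_derivative[OF V(1), of t]
    have "transpose (\<gamma> s) ** V s + transpose (V s) ** \<gamma> s = 0" for s
      using skew_symmetricD[OF V(2)] by simp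
    then have "((\<lambda>s. 0) has_vector_derivative
        (transpose (\<gamma> t) ** ?V + transpose ?G ** V t) + (transpose (V t) ** ?G + transpose ?V ** \<gamma> t))
        (at t)"
      using has_vector_derivative_add[OF has_vector_derivative_transpose_mult[OF d\<gamma> dV]
          has_vector_derivative_transpose_mult[OF dV d\<gamma>]] by simp
    then have *: "(transpose (\<gamma> t) ** ?V + transpose ?G ** V t)
        + (transpose (V t) ** ?G + transpose ?V ** \<gamma> t) = 0"
      by (rule vector_derivative_unique_at[OF _ has_vector_derivative_const])
    \<comment> \<open>\<open>N\<close> is \<open>transpose (\<gamma> t)\<close> times the covariant derivative.\<close>
    define N where "N = transpose (\<gamma> t) ** ?V + (1/2) *\<^sub>R (transpose ?G ** V t + transpose (V t) ** ?G)"
    have "transpose N + N = (transpose (\<gamma> t) ** ?V + transpose ?G ** V t)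
        + (transpose (V t) ** ?G + transpose ?V ** \<gamma> t)"
      by (simp add: N_def matrix_transpose_mul transpose_add transpose_scalar vec_eq_iff field_simps)
    with * have "skew_symmetric N"
      by (simp add: skew_symmetric_def eq_neg_iff_add_eq_0)
    moreover have "\<gamma> t \<in> stiefel"
      using \<gamma> by (simp add: smooth_stiefel_curve_def)
    ultimately show ?thesis
      using transpose_mult_canonical_christoffel[OF _ skew_symmetric_velocity[OF \<gamma>] V(2)]
      by (simp add: cov_deriv_along_def matrix_add_ldistrib N_def)
  qed
  ultimately show "smooth_field_along \<gamma> (cov_deriv_along canonical_christoffel \<gamma> V)"
    by (simp add: smooth_field_along_iff[OF card \<gamma>])
qed (rule bilinear_canonical_christoffel)

lemma stiefel_metric_commute: "stiefel_metric U X Y = stiefel_metric U Y X"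
  by (simp add: stiefel_metric_inner inner_commute)

lemma stiefel_metric_add_left:
  "stiefel_metric U (X + Y) Z = stiefel_metric U X Z + stiefel_metric U Y Z"
  by (simp add: stiefel_metric_inner matrix_add_ldistrib inner_add_left algebra_simps)

lemma stiefel_metric_diff_left:
  "stiefel_metric U (X - Y) Z = stiefel_metric U X Z - stiefel_metric U Y Z"
  by (simp add: stiefel_metric_inner matrix_diff_right inner_diff_left algebra_simps)

lemma metric_compatible_canonical_christoffel:
  assumes card: "CARD('p) < CARD('n)"
  shows "metric_compatible
    (canonical_christoffel :: real^'p^'n \<Rightarrow> real^'p^'n \<Rightarrow> real^'p^'n \<Rightarrow> real^'p^'n)"
  unfolding metric_compatible_def
proof (intro allI impI)
  fix \<gamma> V W :: "real \<Rightarrow> real^'p^'n" and t :: real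
  assume \<gamma>: "smooth_stiefel_curve \<gamma>" and "smooth_field_along \<gamma> V" "smooth_field_along \<gamma> W"
  then have V: "smooth_curve V" "\<And>t. skew_symmetric (transpose (\<gamma> t) ** V t)"
    and W: "smooth_curve W" "\<And>t. skew_symmetric (transpose (\<gamma> t) ** W t)"
    and "smooth_curve \<gamma>" and St: "\<gamma> t \<in> stiefel"
    using smooth_field_along_iff[OF card \<gamma>] by (auto simp: smooth_stiefel_curve_def)
  let ?G = "vector_derivative \<gamma> (at t)" and ?V = "vector_derivative V (at t)"
    and ?W = "vector_derivative W (at t)"
  let ?\<gamma>V = "transpose (\<gamma> t) ** V t" and ?\<gamma>W = "transpose (\<gamma> t) ** W t"
  note d = \<open>smooth_curve \<gamma>\<close>[THEN smooth_curve_has_vector_derivative, of t]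
    V(1)[THEN smooth_curve_has_vector_derivative, of t]
    W(1)[THEN smooth_curve_has_vector_derivative, of t]
  note d_inner = bounded_bilinear.has_vector_derivative[OF bounded_bilinear_inner]
  note G = skew_symmetric_velocity[OF \<gamma>, of t]
  have deriv: "((\<lambda>s. stiefel_metric (\<gamma> s) (V s) (W s)) has_real_derivative
      (V t \<bullet> ?W + ?V \<bullet> W t) - 1/2 * (?\<gamma>V \<bullet> (transpose (\<gamma> t) ** ?W + transpose ?G ** W t)
        + (transpose (\<gamma> t) ** ?V + transpose ?G ** V t) \<bullet> ?\<gamma>W)) (at t)"
    unfolding stiefel_metric_inner has_real_derivative_iff_has_vector_derivative
    by (intro has_vector_derivative_diff has_vector_derivative_mult_right d_inner
        has_vector_derivative_transpose_mult d)
  have adj: "(?G ** ?\<gamma>V) \<bullet> W t = ?\<gamma>V \<bullet> (transpose ?G ** W t)"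
    "(?G ** ?\<gamma>W) \<bullet> V t = ?\<gamma>W \<bullet> (transpose ?G ** V t)"
    by (rule inner_mult_left_adjoint)+
  have skew: "(W t ** (transpose (\<gamma> t) ** ?G)) \<bullet> V t = - ((V t ** (transpose (\<gamma> t) ** ?G)) \<bullet> W t)"
    using G by (subst inner_mult_right_adjoint)
      (simp add: skew_symmetric_def matrix_minus_right inner_commute)
  show "((\<lambda>s. stiefel_metric (\<gamma> s) (V s) (W s)) has_real_derivative
      stiefel_metric (\<gamma> t) (cov_deriv_along canonical_christoffel \<gamma> V t) (W t)
      + stiefel_metric (\<gamma> t) (V t) (cov_deriv_along canonical_christoffel \<gamma> W t)) (at t)"
  proof (rule DERIV_cong[OF deriv])
    show "(V t \<bullet> ?W + ?V \<bullet> W t) - 1/2 * (?\<gamma>V \<bullet> (transpose (\<gamma> t) ** ?W + transpose ?G ** W t)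
        + (transpose (\<gamma> t) ** ?V + transpose ?G ** V t) \<bullet> ?\<gamma>W)
      = stiefel_metric (\<gamma> t) (cov_deriv_along canonical_christoffel \<gamma> V t) (W t)
      + stiefel_metric (\<gamma> t) (V t) (cov_deriv_along canonical_christoffel \<gamma> W t)"
      unfolding cov_deriv_along_def stiefel_metric_commute[of "\<gamma> t" "V t"] stiefel_metric_add_left
        stiefel_metric_canonical_christoffel[OF St G V(2) W(2)]
        stiefel_metric_canonical_christoffel[OF St G W(2) V(2)]
      using adj skew
      by (simp add: stiefel_metric_inner inner_add inner_commute) (simp add: field_simps)
  qed
qed

text \<open>Every tangent vector \<open>X\<close> at \<open>U\<close> is \<open>\<Omega> ** U\<close> for a skew-symmetric \<open>\<Omega>\<close>. The isometries
  \<open>mat_exp (t *\<^sub>R \<Omega>)\<close> move \<open>U\<close> along a curve with initial velocity \<open>X\<close>, and carry tangent vectors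
  at \<open>U\<close> to tangent fields along it. As \<open>transpose X ** U = - transpose U ** X\<close>, the first two
  terms of \<open>\<Omega>\<close> send \<open>U\<close> to \<open>X + U ** (transpose U ** X)\<close>; the last one removes the excess.\<close>

definition rotation_generator :: "real^'p^'n \<Rightarrow> real^'p^'n \<Rightarrow> real^'n^'n" where
  "rotation_generator U X =
     X ** transpose U - U ** transpose X - U ** (transpose U ** X) ** transpose U"

lemma skew_symmetric_rotation_generator:
  assumes "skew_symmetric (transpose U ** X)"
  shows "skew_symmetric (rotation_generator U X)"
proof -
  have "transpose (U ** A ** transpose U) = U ** transpose A ** transpose U" for A
    by (simp add: matrix_transpose_mul matrix_mul_assoc)
  then have "transpose (U ** (transpose U ** X) ** transpose U) = - (U ** (transpose U ** X) ** transpose U)"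
    using assms by (simp only: skew_symmetric_def matrix_minus_left matrix_minus_right)
  then show ?thesis
    unfolding skew_symmetric_def rotation_generator_def transpose_diff
    by (simp add: matrix_transpose_mul)
qed

lemma rotation_generator_mult:
  assumes "U \<in> stiefel" "skew_symmetric (transpose U ** X)"
  shows "rotation_generator U X ** U = X"
  using skew_symmetricD[OF assms(2)]
  by (simp add: rotation_generator_def matrix_diff_left stiefel_cancel[OF assms(1)])
     (simp add: matrix_mul_assoc[symmetric] matrix_minus_right)

lemma has_vector_derivative_mat_exp_mult:
  "((\<lambda>t. mat_exp (t *\<^sub>R M) ** X) has_vector_derivative M ** mat_exp (t *\<^sub>R M) ** X) (at t)"
  by (rule bounded_linear.has_vector_derivative[OF
        bounded_bilinear.bounded_linear_left[OF bounded_bilinear_matrix_mult]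
        has_vector_derivative_mat_exp])

text \<open>Rotated fields have constant inner products, so that metric compatibility along a rotated
  curve makes \<open>Y \<mapsto> \<Omega> ** Y + \<Gamma> U X Y\<close> a skew-adjoint operator on the tangent space at \<open>U\<close>.\<close>

lemma connection_along_rotation:
  fixes U X Y Z :: "real^'p^'n"
  assumes card: "CARD('p) < CARD('n)"
    and \<Gamma>: "stiefel_connection \<Gamma>" "metric_compatible \<Gamma>"
    and U: "U \<in> stiefel" and X: "X \<in> stiefel_tangent U"
    and Y: "Y \<in> stiefel_tangent U" and Z: "Z \<in> stiefel_tangent U"
  defines "\<Omega> \<equiv> rotation_generator U X"
  shows "\<Omega> ** Y + \<Gamma> U X Y \<in> stiefel_tangent U"
    and "stiefel_metric U (\<Omega> ** Y + \<Gamma> U X Y) Z + stiefel_metric U (\<Omega> ** Z + \<Gamma> U X Z) Y = 0"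
proof -
  note tangent = stiefel_tangent_iff[OF U card]
  define R where "R X t = mat_exp (t *\<^sub>R \<Omega>) ** X" for X :: "real^'p^'n" and t
  have \<Omega>: "skew_symmetric \<Omega>" "\<Omega> ** U = X"
    using X U by (simp_all add: \<Omega>_def tangent skew_symmetric_rotation_generator rotation_generator_mult)
  have gram: "transpose (R V t) ** R W t = transpose V ** W" for V W t
    unfolding R_def by (rule transpose_mult_isometry[OF mat_exp_skew_orthogonal[OF \<Omega>(1)]])
  have smooth: "smooth_curve (R V)" for V
    unfolding R_def[abs_def] by (intro smooth_curve_intros)
  have R0: "R V 0 = V" and deriv: "vector_derivative (R V) (at 0) = \<Omega> ** V" for V
    using vector_derivative_at[OF has_vector_derivative_mat_exp_mult[of \<Omega> V 0]]
    by (simp_all add: R_def[abs_def] mat_exp_zero)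
  have curve: "smooth_stiefel_curve (R U)"
    using U smooth by (simp add: smooth_stiefel_curve_def stiefel_def gram)
  have field: "smooth_field_along (R U) (R V)" if "V \<in> stiefel_tangent U" for V
    using that smooth by (simp add: smooth_field_along_iff[OF card curve] gram tangent)
  have cov: "cov_deriv_along \<Gamma> (R U) (R V) 0 = \<Omega> ** V + \<Gamma> U X V" for V
    by (simp add: cov_deriv_along_def deriv R0 \<Omega>)
  have "smooth_field_along (R U) (cov_deriv_along \<Gamma> (R U) (R Y))"
    using \<Gamma>(1) curve field[OF Y] by (simp add: stiefel_connection_def)
  then have "cov_deriv_along \<Gamma> (R U) (R Y) 0 \<in> stiefel_tangent (R U 0)"
    unfolding smooth_field_along_def by blast
  then show "\<Omega> ** Y + \<Gamma> U X Y \<in> stiefel_tangent U"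
    by (simp add: cov R0)
  have const: "(\<lambda>s. stiefel_metric (R U s) (R Y s) (R Z s)) = (\<lambda>s. stiefel_metric U Y Z)"
    by (rule ext) (simp only: stiefel_metric_inner gram trace_transpose_mult[symmetric])
  have "((\<lambda>s. stiefel_metric (R U s) (R Y s) (R Z s)) has_real_derivative
      stiefel_metric (R U 0) (cov_deriv_along \<Gamma> (R U) (R Y) 0) (R Z 0) +
      stiefel_metric (R U 0) (R Y 0) (cov_deriv_along \<Gamma> (R U) (R Z) 0)) (at 0)"
    using \<Gamma>(2) curve field[OF Y] field[OF Z] unfolding metric_compatible_def by blast
  then have "((\<lambda>s. stiefel_metric U Y Z) has_real_derivative
      stiefel_metric U (\<Omega> ** Y + \<Gamma> U X Y) Z + stiefel_metric U Y (\<Omega> ** Z + \<Gamma> U X Z)) (at 0)"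
    by (simp only: cov R0 const)
  then show "stiefel_metric U (\<Omega> ** Y + \<Gamma> U X Y) Z + stiefel_metric U (\<Omega> ** Z + \<Gamma> U X Z) Y = 0"
    unfolding stiefel_metric_commute[of U Y] by (rule DERIV_unique[OF _ DERIV_const])
qed

text \<open>The difference of two Levi-Civita connections is symmetric in its two arguments and
  skew-adjoint in the second; a trilinear form that is symmetric in the first two and alternating
  in the last two arguments vanishes.\<close>

lemma levi_civita_unique:
  fixes U X Y :: "real^'p^'n"
  assumes card: "CARD('p) < CARD('n)"
    and \<Gamma>: "stiefel_connection \<Gamma>" "torsion_free \<Gamma>" "metric_compatible \<Gamma>"
    and \<Gamma>': "stiefel_connection \<Gamma>'" "torsion_free \<Gamma>'" "metric_compatible \<Gamma>'"
    and U: "U \<in> stiefel" and X: "X \<in> stiefel_tangent U" and Y: "Y \<in> stiefel_tangent U"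
  shows "\<Gamma> U X Y = \<Gamma>' U X Y"
proof -
  define T where "T = stiefel_tangent U"
  define f where "f X Y Z = stiefel_metric U (\<Gamma> U X Y - \<Gamma>' U X Y) Z" for X Y Z
  have sym: "f X Y Z = f Y X Z" if "X \<in> T" "Y \<in> T" for X Y Z
    using \<Gamma>(2) \<Gamma>'(2) U that by (simp add: f_def T_def torsion_free_def)
  have alt: "f X Y Z = - f X Z Y" if "X \<in> T" "Y \<in> T" "Z \<in> T" for X Y Z
    using connection_along_rotation(2)[OF card \<Gamma>(1,3) U that[unfolded T_def]]
      connection_along_rotation(2)[OF card \<Gamma>'(1,3) U that[unfolded T_def]]
    by (simp add: f_def stiefel_metric_add_left stiefel_metric_diff_left)
  have zero: "f X Y Z = 0" if "X \<in> T" "Y \<in> T" "Z \<in> T" for X Y Z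
    \<comment> \<open>Alternating between the two symmetries, six steps lead from \<open>f X Y Z\<close> back to its negative.\<close>
    using that sym[of X Y Z] alt[of X Y Z] sym[of X Z Y] alt[of Z X Y] sym[of Z Y X] alt[of Y Z X]
    by linarith
  have "\<Gamma> U X Y - \<Gamma>' U X Y \<in> T"
    using connection_along_rotation(1)[OF card \<Gamma>(1,3) U X Y Y]
      connection_along_rotation(1)[OF card \<Gamma>'(1,3) U X Y Y]
      skew_symmetric_diff[of "transpose U ** (_ + \<Gamma> U X Y)" "transpose U ** (_ + \<Gamma>' U X Y)"]
    by (force simp: T_def stiefel_tangent_iff[OF U card] matrix_diff_right[symmetric])
  with X Y have "f X Y (\<Gamma> U X Y - \<Gamma>' U X Y) = 0"
    by (intro zero) (simp_all add: T_def)
  then have "\<Gamma> U X Y - \<Gamma>' U X Y = 0"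
    by (intro stiefel_metric_zeroD[OF U]) (simp add: f_def)
  then show ?thesis by simp
qed

lemma levi_civita_eq_canonical_christoffel:
  fixes U X Y :: "real^'p^'n"
  assumes card: "CARD('p) < CARD('n)" and "U \<in> stiefel"
    and "X \<in> stiefel_tangent U" "Y \<in> stiefel_tangent U"
  shows "levi_civita U X Y = canonical_christoffel U X Y"
proof -
  let ?LC = "\<lambda>\<Gamma> :: real^'p^'n \<Rightarrow> real^'p^'n \<Rightarrow> real^'p^'n \<Rightarrow> real^'p^'n.
    stiefel_connection \<Gamma> \<and> torsion_free \<Gamma> \<and> metric_compatible \<Gamma>"
  have *: "?LC canonical_christoffel"
    using stiefel_connection_canonical_christoffel[OF card]
      metric_compatible_canonical_christoffel[OF card]
    by (simp add: torsion_free_def canonical_christoffel_commute)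
  then have "?LC levi_civita"
    unfolding levi_civita_def by (rule someI[of ?LC])
  with * assms show ?thesis
    by (intro levi_civita_unique) auto
qed

section \<open>Velocity and covariant acceleration in an orthonormal frame\<close>

lemma mult_vcat_split:
  "K ** vcat X Y = K ** vcat (mat 1) 0 ** X + K ** vcat 0 (mat 1) ** Y"
  for K :: "real^('p::finite + 'q::finite)^'n" and X :: "real^'k^'p" and Y :: "real^'k^'q"
  by (simp add: matrix_mul_assoc[symmetric] vcat_mult vcat_add flip: matrix_add_ldistrib)

lemma frame_columns:
  fixes K :: "real^('p::finite + 'q::finite)^'n"
  assumes "transpose K ** K = mat 1"
  defines "R \<equiv> K ** vcat (mat 1) 0" and "P \<equiv> K ** vcat 0 (mat 1)"
  shows "transpose R ** R = mat 1" "transpose P ** P = mat 1"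
    "transpose R ** P = 0" "transpose P ** R = 0"
proof -
  show "transpose R ** R = mat 1" "transpose P ** P = mat 1"
    "transpose R ** P = 0" "transpose P ** R = 0"
    by (simp_all add: R_def P_def transpose_mult_isometry[OF assms(1)] transpose_vcat
        hcat_mult_vcat transpose_zero)
qed

text \<open>The pointwise content of the speed and acceleration formulas, for a velocity \<open>X\<close> with
  coordinates \<open>(A, B)\<close> in an orthonormal frame \<open>(R, P)\<close>; in the last equation, the terms before
  \<open>canonical_christoffel\<close> are the second derivative of the curve.\<close>

lemma orthonormal_frame_velocity:
  fixes R P :: "real^'p^'n" and A B C :: "real^'p^'p"
  assumes R: "transpose R ** R = mat 1" and P: "transpose P ** P = mat 1"
    and RP: "transpose R ** P = 0" and PR: "transpose P ** R = 0"
    and A: "skew_symmetric A"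
  defines "X \<equiv> R ** A + P ** B"
  shows "transpose R ** X = A"
    and "stiefel_metric R X X = 1/2 * trace (transpose A ** A) + trace (transpose B ** B)"
    and "R ** (A ** A - transpose B ** B) + P ** (B ** A + C ** B) + canonical_christoffel R X X
      = P ** (C ** B)"
proof -
  have R': "L ** transpose R ** R = L" "L ** transpose R ** P = 0" for L :: "real^'p^'m"
    using R RP by (simp_all add: matrix_mul_assoc[symmetric])
  have P': "L ** transpose P ** P = L" "L ** transpose P ** R = 0" for L :: "real^'p^'m"
    using P PR by (simp_all add: matrix_mul_assoc[symmetric])
  show RX: "transpose R ** X = A"
    using R RP by (simp add: X_def matrix_add_ldistrib matrix_mul_assoc)
  have XR: "transpose X ** R = - A"
    using A RX skew_symmetricD[of R X] by simp
  have gram: "transpose X ** X = transpose A ** A + transpose B ** B"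
    by (simp add: X_def matrix_ring_simps R' P')
  then have XX: "transpose X ** X = - (A ** A) + transpose B ** B"
    using A by (simp only: skew_symmetric_def matrix_minus_left)
  have "X \<bullet> X = trace (transpose A ** A) + trace (transpose B ** B)"
    by (simp only: trace_transpose_mult[symmetric] gram trace_add)
  then show "stiefel_metric R X X = 1/2 * trace (transpose A ** A) + trace (transpose B ** B)"
    by (simp add: stiefel_metric_inner RX trace_transpose_mult)
  have "canonical_christoffel R X X
      = (1/2) *\<^sub>R (X ** - A + X ** - A + R ** (A ** A + A ** A + (- (A ** A) + transpose B ** B)
          + (- (A ** A) + transpose B ** B)))"
    by (simp only: canonical_christoffel_def RX XX XR matrix_mul_assoc[symmetric])
  also have "\<dots> = - (X ** A) + R ** (transpose B ** B)"
    by (simp only: matrix_add_ldistrib matrix_minus_right) (simp add: vec_eq_iff)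
  finally show "R ** (A ** A - transpose B ** B) + P ** (B ** A + C ** B)
      + canonical_christoffel R X X = P ** (C ** B)"
    by (simp add: X_def matrix_ring_simps)
qed

theorem proposition3:
  fixes U Q :: "real^'p^'n"
    and A B C :: "real^'p^'p"
    and E :: "real \<Rightarrow> real^('p + 'p)^('p + 'p)"
    and \<rho> \<rho>perp :: "real \<Rightarrow> real^'p^'n"
  assumes "U \<in> stiefel" and "Q \<in> stiefel" and "transpose U ** Q = 0"
    and "skew_symmetric A" and "skew_symmetric C"
    and E_def: "E = (\<lambda>t. mat_exp (t *\<^sub>R vcat (hcat A (- transpose B)) (hcat B C)))"
    and \<rho>_def: "\<rho> = (\<lambda>t. hcat U Q ** E t ** vcat (mat 1) 0)"
    and \<rho>perp_def: "\<rho>perp = (\<lambda>t. hcat U Q ** E t ** vcat 0 (mat 1))"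
  shows "smooth_stiefel_curve \<rho>
     \<and> \<rho> 0 = U
     \<and> ((\<rho> has_vector_derivative (U ** A + Q ** B)) (at 0)
         \<and> U ** A + Q ** B \<in> stiefel_tangent U)
     \<and> (\<forall>t. (\<rho> has_vector_derivative (hcat U Q ** E t ** vcat A B)) (at t)
         \<and> hcat U Q ** E t ** vcat A B = \<rho> t ** A + \<rho>perp t ** B
         \<and> \<rho> t ** A + \<rho>perp t ** B \<in> stiefel_tangent (\<rho> t))
     \<and> (\<forall>t. (stiefel_norm (\<rho> t) (vector_derivative \<rho> (at t)))\<^sup>2
         = 1/2 * trace (transpose A ** A) + trace (transpose B ** B))
     \<and> (\<forall>t. ((\<lambda>s. vector_derivative \<rho> (at s)) has_vector_derivative
           (hcat U Q ** E t ** vcat (A ** A - transpose B ** B) (B ** A + C ** B))) (at t)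
         \<and> hcat U Q ** E t ** vcat (A ** A - transpose B ** B) (B ** A + C ** B)
           = \<rho> t ** (A ** A - transpose B ** B) + \<rho>perp t ** (B ** A + C ** B))
     \<and> (\<forall>t. stiefel_cov_deriv \<rho> (\<lambda>s. vector_derivative \<rho> (at s)) t = \<rho>perp t ** (C ** B))
     \<and> (\<forall>t. (stiefel_norm (\<rho> t)
             (stiefel_cov_deriv \<rho> (\<lambda>s. vector_derivative \<rho> (at s)) t))\<^sup>2
         = (frobenius_norm (C ** B))\<^sup>2)"
proof -
  define M where "M = vcat (hcat A (- transpose B)) (hcat B C)"
  define K where "K t = hcat U Q ** E t" for t
  have card: "CARD('p) < CARD('n)"
    by (rule card_less_if_orthogonal_frames[OF assms(1-3)])
  have M: "skew_symmetric M"
    using assms(4,5) by (simp add: skew_symmetric_def M_def transpose_vcat transpose_hcat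
        vcat_hcat_swap[symmetric] uminus_vcat uminus_hcat transpose_uminus)
  have E: "E t = mat_exp (t *\<^sub>R M)" for t
    by (simp add: E_def M_def)
  have K_ortho: "transpose (K t) ** K t = mat 1" for t
  proof -
    have "transpose (hcat U Q) ** hcat U Q = mat 1"
      using assms(1,2)[THEN stiefelD] assms(3) by (rule transpose_hcat_mult_hcat_orthonormal)
    then have "transpose (K t) ** K t = transpose (E t) ** E t"
      unfolding K_def by (rule transpose_mult_isometry)
    then show ?thesis by (simp add: E mat_exp_skew_orthogonal[OF M])
  qed
  have K_deriv: "((\<lambda>t. K t ** V) has_vector_derivative K t ** (M ** V)) (at t)"
    for t and V :: "real^'p^('p + 'p)"
  proof -
    have "((\<lambda>t. hcat U Q ** (E t ** V)) has_vector_derivative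
        hcat U Q ** (M ** mat_exp (t *\<^sub>R M) ** V)) (at t)"
      unfolding E by (rule bounded_linear.has_vector_derivative[OF
            bounded_bilinear.bounded_linear_right[OF bounded_bilinear_matrix_mult]
            has_vector_derivative_mat_exp_mult])
    then show ?thesis
      by (simp add: K_def E mat_exp_scaleR_commute[symmetric] matrix_mul_assoc)
  qed
  have \<rho>: "\<rho> t = K t ** vcat (mat 1) 0" and \<rho>perp: "\<rho>perp t = K t ** vcat 0 (mat 1)" for t
    by (simp_all add: \<rho>_def \<rho>perp_def K_def)
  note frame = frame_columns[OF K_ortho, folded \<rho> \<rho>perp]
  have split: "K t ** vcat X Y = \<rho> t ** X + \<rho>perp t ** Y" for t and X Y :: "real^'p^'p"
    by (simp add: mult_vcat_split[of _ X] \<rho> \<rho>perp)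
  have MA: "M ** vcat (mat 1) 0 = vcat A B"
    by (simp add: M_def vcat_mult hcat_mult_vcat)
  have MMA: "M ** vcat A B = vcat (A ** A - transpose B ** B) (B ** A + C ** B)"
    by (simp add: M_def vcat_mult hcat_mult_vcat matrix_minus_left)
  have d\<rho>: "(\<rho> has_vector_derivative K t ** vcat A B) (at t)" for t
    using K_deriv[of "vcat (mat 1) 0" t] by (simp add: MA \<rho>[abs_def])
  then have vd: "vector_derivative \<rho> (at t) = \<rho> t ** A + \<rho>perp t ** B" for t
    by (simp add: vector_derivative_at split)
  have d2\<rho>: "((\<lambda>s. vector_derivative \<rho> (at s)) has_vector_derivative
      K t ** vcat (A ** A - transpose B ** B) (B ** A + C ** B)) (at t)" for t
    using K_deriv[of "vcat A B" t] by (simp add: MMA vd split)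
  have St: "\<rho> t \<in> stiefel" for t
    using frame(1) by (simp add: stiefel_def)
  note velocity = orthonormal_frame_velocity[OF frame assms(4)]
  have tangent: "\<rho> t ** A + \<rho>perp t ** B \<in> stiefel_tangent (\<rho> t)" for t
    using assms(4) by (simp add: stiefel_tangent_iff[OF St card] velocity(1))
  have "smooth_curve \<rho>"
    unfolding \<rho>_def E[abs_def] by (intro smooth_curve_intros)
  then have smooth: "smooth_stiefel_curve \<rho>"
    using St by (simp add: smooth_stiefel_curve_def)
  have "K 0 = hcat U Q" by (simp add: K_def E mat_exp_zero)
  then have \<rho>0: "\<rho> 0 = U" and \<rho>perp0: "\<rho>perp 0 = Q"
    by (simp_all add: \<rho> \<rho>perp hcat_mult_vcat)
  have speed: "(stiefel_norm (\<rho> t) (vector_derivative \<rho> (at t)))\<^sup>2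
      = 1/2 * trace (transpose A ** A) + trace (transpose B ** B)" for t
    by (simp add: stiefel_norm_def vd velocity(2)) (simp add: trace_transpose_mult)
  have cov: "stiefel_cov_deriv \<rho> (\<lambda>s. vector_derivative \<rho> (at s)) t = \<rho>perp t ** (C ** B)" for t
  proof -
    have "stiefel_cov_deriv \<rho> (\<lambda>s. vector_derivative \<rho> (at s)) t
        = \<rho> t ** (A ** A - transpose B ** B) + \<rho>perp t ** (B ** A + C ** B)
          + canonical_christoffel (\<rho> t) (\<rho> t ** A + \<rho>perp t ** B) (\<rho> t ** A + \<rho>perp t ** B)"
      using vector_derivative_at[OF d2\<rho>[of t]]
      by (simp add: stiefel_cov_deriv_def cov_deriv_along_def vd split
          levi_civita_eq_canonical_christoffel[OF card St tangent tangent])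
    then show ?thesis by (simp only: velocity(3))
  qed
  have acceleration: "(stiefel_norm (\<rho> t) (\<rho>perp t ** (C ** B)))\<^sup>2 = (norm (C ** B))\<^sup>2" for t
  proof -
    have "(\<rho>perp t ** (C ** B)) \<bullet> (\<rho>perp t ** (C ** B)) = (C ** B) \<bullet> (C ** B)"
      by (simp only: inner_mult_left_adjoint matrix_mul_assoc[of "transpose (\<rho>perp t)"] frame(2)
          matrix_mul_lid)
    moreover have "transpose (\<rho> t) ** (\<rho>perp t ** (C ** B)) = 0"
      by (simp only: matrix_mul_assoc[of "transpose (\<rho> t)"] frame(3) times0_left)
    ultimately show ?thesis
      by (simp add: stiefel_norm_def stiefel_metric_inner power2_norm_eq_inner)
  qed
  show ?thesis
    unfolding cov acceleration
    using smooth \<rho>0 d\<rho>[of 0] tangent[of 0] d\<rho> tangent speed d2\<rho>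
    by (simp add: split \<rho>0 \<rho>perp0 K_def[symmetric])
qed

end
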